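(* Let $X_0 > 1$ be a constant, and let $X_1,\dots, X_k$ be random variables satisfying $X_{i+1}-1\ge 2(X_i-1)$ and $\mathbb{E}[X_{i+1}\mid X_0,\dots,X_i]\le X_i^2$ for all $0\le i<k$. Then for every real $t$ with $1 + 4(X_0-1)\le t\le 2$, \[\Pr\left[X_k\ge t^{2^{k-1}}\right]\le 48\left(\frac{X_0-1}{t-1}\right)^2.\] *)

theory Defs
  imports "HOL-Probability.Probability"
begin

definition history_algebra :: "'a measure \<Rightarrow> (nat \<Rightarrow> 'a \<Rightarrow> real) \<Rightarrow> nat \<Rightarrow> 'a measure" where
  "history_algebra M X i =
     sigma (space M) (\<Union>j\<in>{..i}. {X j -` A \<inter> space M | A. A \<in> sets borel})"

text \<open>
  Conditional expectation given \<open>X 0, \<dots>, X i\<close>, with values in \<open>[0, \<infinity>]\<close>.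
  It is meant for almost surely nonnegative \<open>Y\<close>: then it agrees almost everywhere with
  \<^const>\<open>real_cond_exp\<close> whenever \<open>Y\<close> is integrable, and it stays meaningful
  when \<open>Y\<close> is not, whereas \<^const>\<open>real_cond_exp\<close> is \<open>0\<close> wherever the conditional
  expectation of a nonnegative variable is infinite.
\<close>
definition cond_exp_history ::
    "'a measure \<Rightarrow> (nat \<Rightarrow> 'a \<Rightarrow> real) \<Rightarrow> nat \<Rightarrow> ('a \<Rightarrow> real) \<Rightarrow> 'a \<Rightarrow> ennreal" where
  "cond_exp_history M X i Y = nn_cond_exp M (history_algebra M X i) (\<lambda>\<omega>. ennreal (Y \<omega>))"

end

theory Submission
  imports Defs
begin

text \<open>
  Put \<open>T\<^sub>i = t powr (2 powr (i - 1))\<close>, so that \<open>T\<^sub>i\<^sub>+\<^sub>1 = T\<^sub>i\<^sup>2\<close>. The potential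
  \<open>min 1 (((X\<^sub>i - 1) / (T\<^sub>i - 1))\<^sup>2)\<close> has nonincreasing expectation: on \<open>[2 X\<^sub>i - 1, \<infinity>)\<close> the
  potential of step \<open>i + 1\<close> lies below the chord from the left end point to the point where
  the potential reaches \<open>1\<close>, and the chord evaluated at the largest admissible mean \<open>X\<^sub>i\<^sup>2\<close> is at
  most the potential of step \<open>i\<close>. At step \<open>k\<close> the potential dominates the indicator of the
  event, and at step \<open>0\<close> it is at most \<open>((sqrt t + 1) (x0 - 1) / (t - 1))\<^sup>2\<close>.
\<close>

section \<open>The truncated quadratic potential and its chord\<close>

definition potential :: "real \<Rightarrow> real \<Rightarrow> real" where
  "potential a x = min 1 (((x - 1) / a)\<^sup>2)"

lemma potential_nonneg: "0 \<le> potential a x"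
  by (simp add: potential_def)

lemma potential_le_1: "potential a x \<le> 1"
  by (simp add: potential_def)

lemma potential_eq_1:
  assumes "0 < a" "1 + a \<le> x"
  shows "potential a x = 1"
proof -
  have "1 \<le> (x - 1) / a" using assms by simp
  then have "1 \<le> ((x - 1) / a)\<^sup>2" by (simp add: one_le_power)
  then show ?thesis by (simp add: potential_def)
qed

lemma potential_measurable [measurable]: "potential a \<in> borel_measurable borel"
  unfolding potential_def by measurable

text \<open>With \<open>d = x - 1\<close>, the quotient (1 - (2d/b)^2) / (b - 2d) between the graph
  points at y = 1 + 2d and y = 1 + b, after cancelling b - 2d; this form also covers the degenerate
  case 2d = b.\<close>

definition chord_slope :: "real \<Rightarrow> real \<Rightarrow> real" where
  "chord_slope b x = (b + 2 * (x - 1)) / b\<^sup>2"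

text \<open>The chord is \<open>y \<mapsto> chord_slope b x * y - chord_offset b x\<close>; both coefficients are
  nonnegative, so all integrals below can be taken in \<open>[0, \<infinity>]\<close>.\<close>
definition chord_offset :: "real \<Rightarrow> real \<Rightarrow> real" where
  "chord_offset b x = (b + 2 * (x - 1) + 2 * (x - 1) * b) / b\<^sup>2"

text \<open>Scaled by b^2, the chord is 4d^2 + (z - 2d)(b + 2d). Up to z = b it lies above the
  parabola z^2 by convexity; beyond that it is increasing and already at least b^2, where the
  potential is capped.\<close>

lemma potential_le_chord:
  assumes "0 < b" "1 \<le> x" "2 * (x - 1) \<le> b" "2 * (x - 1) \<le> y - 1"
  shows "potential b y + chord_offset b x \<le> chord_slope b x * y"
proof -
  define d z where "d = x - 1" and "z = y - 1"
  have *: "0 \<le> d" "2 * d \<le> b" "2 * d \<le> z" using assms by (auto simp: d_def z_def)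
  have "potential b y * b\<^sup>2 \<le> 4 * d\<^sup>2 + (z - 2 * d) * (b + 2 * d)"
  proof (cases "z \<le> b")
    case True
    have "potential b y * b\<^sup>2 \<le> (z / b)\<^sup>2 * b\<^sup>2"
      by (intro mult_right_mono) (auto simp: potential_def z_def)
    also have "\<dots> = z\<^sup>2" using assms(1) by (simp add: power_divide)
    also have "z\<^sup>2 = 4 * d\<^sup>2 + (z - 2 * d) * (z + 2 * d)"
      by (simp add: power2_eq_square algebra_simps)
    also have "\<dots> \<le> 4 * d\<^sup>2 + (z - 2 * d) * (b + 2 * d)"
      using True * by (intro add_left_mono mult_left_mono) auto
    finally show ?thesis .
  next
    case False
    have "potential b y * b\<^sup>2 \<le> 1 * b\<^sup>2"
      by (intro mult_right_mono potential_le_1) auto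
    also have "\<dots> = 4 * d\<^sup>2 + (b - 2 * d) * (b + 2 * d)"
      by (simp add: power2_eq_square algebra_simps)
    also have "\<dots> \<le> 4 * d\<^sup>2 + (z - 2 * d) * (b + 2 * d)"
      using False * assms(1) by (intro add_left_mono mult_right_mono) auto
    finally show ?thesis .
  qed
  also have "\<dots> = (b + 2 * d) * y - (b + 2 * d + 2 * d * b)"
    by (simp add: z_def power2_eq_square algebra_simps)
  finally have "potential b y * b\<^sup>2 + (b + 2 * d + 2 * d * b) \<le> (b + 2 * d) * y" by simp
  then have "(potential b y * b\<^sup>2 + (b + 2 * d + 2 * d * b)) / b\<^sup>2 \<le> ((b + 2 * d) * y) / b\<^sup>2"
    by (rule divide_right_mono) simp
  moreover have "(potential b y * b\<^sup>2 + (b + 2 * d + 2 * d * b)) / b\<^sup>2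
      = potential b y + (b + 2 * d + 2 * d * b) / b\<^sup>2"
    using assms(1) by (simp add: add_divide_distrib)
  ultimately show ?thesis
    by (simp add: chord_offset_def chord_slope_def d_def)
qed

text \<open>The scale \<open>a * (a + 2)\<close> is (1 + a)^2 - 1, that of the next step. Scaled by
  b^2, the chord at x^2 equals d^2 (b + 2d + 4), and d \<le> a turns the last factor into at most (a
  + 2)^2 = (b / a)^2.\<close>

lemma chord_at_square_le_potential:
  assumes "0 < a" "1 \<le> x" "x - 1 \<le> a"
  shows "chord_slope (a * (a + 2)) x * x\<^sup>2 \<le> potential a x + chord_offset (a * (a + 2)) x"
proof -
  define d b where "d = x - 1" and "b = a * (a + 2)"
  have d: "0 \<le> d" "d \<le> a" and b: "0 < b" using assms by (auto simp: d_def b_def)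
  have "((x - 1) / a)\<^sup>2 \<le> 1"
    using assms by (intro power_le_one) auto
  then have pot: "potential a x = (d / a)\<^sup>2" by (simp add: potential_def d_def)
  have "(b + 2 * d) * x\<^sup>2 - (b + 2 * d + 2 * d * b) = d\<^sup>2 * (b + 2 * d + 4)"
    by (simp add: d_def power2_eq_square algebra_simps)
  also have "\<dots> \<le> d\<^sup>2 * (a + 2)\<^sup>2"
    using d by (intro mult_left_mono) (auto simp: b_def power2_eq_square algebra_simps)
  also have "\<dots> = (d / a)\<^sup>2 * b\<^sup>2"
    using assms(1) by (simp add: b_def power_divide power_mult_distrib)
  finally have "(b + 2 * d) * x\<^sup>2 \<le> (d / a)\<^sup>2 * b\<^sup>2 + (b + 2 * d + 2 * d * b)" by simp
  then have "(b + 2 * d) * x\<^sup>2 / b\<^sup>2 \<le> ((d / a)\<^sup>2 * b\<^sup>2 + (b + 2 * d + 2 * d * b)) / b\<^sup>2"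
    by (rule divide_right_mono) simp
  also have "\<dots> = (d / a)\<^sup>2 + (b + 2 * d + 2 * d * b) / b\<^sup>2"
    using b by (simp add: add_divide_distrib)
  finally show ?thesis
    unfolding pot by (simp add: chord_offset_def chord_slope_def b_def d_def)
qed

section \<open>Monotonicity of the expected potential in one step\<close>

text \<open>The chord is affine in \<open>y\<close> with \<open>F\<close>-measurable coefficients,
  so under the integral \<open>y\<close> may be replaced by its conditional expectation, which is at
  most x^2. Adding the offset to both sides avoids subtraction in [0, \<infinity>] and any
  integrability assumption on \<open>y\<close>.\<close>

lemma (in sigma_finite_subalgebra) nn_integral_potential_step:
  fixes x y :: "'a \<Rightarrow> real"
  assumes "finite_measure M"
    and xF [measurable]: "x \<in> borel_measurable F"
    and yM [measurable]: "y \<in> borel_measurable M"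
    and x1: "AE \<omega> in M. 1 \<le> x \<omega>"
    and gap: "AE \<omega> in M. y \<omega> - 1 \<ge> 2 * (x \<omega> - 1)"
    and cond: "AE \<omega> in M. nn_cond_exp M F (\<lambda>\<omega>. ennreal (y \<omega>)) \<omega> \<le> ennreal ((x \<omega>)\<^sup>2)"
    and a: "0 < a"
  shows "(\<integral>\<^sup>+ \<omega>. ennreal (potential (a * (a + 2)) (y \<omega>)) \<partial>M) \<le> (\<integral>\<^sup>+ \<omega>. ennreal (potential a (x \<omega>)) \<partial>M)"
proof -
  interpret finite_measure M by fact
  have xM [measurable]: "x \<in> borel_measurable M"
    using measurable_from_subalg[OF subalg xF] .
  define b where "b = a * (a + 2)"
  have b: "0 < b" using a by (simp add: b_def)
  have ab: "2 * a \<le> b" using a by (simp add: b_def algebra_simps)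
  \<comment> \<open>The chord is used only where \<open>low\<close> holds. For larger
    \<open>x\<close> the current potential is already 1, and the constant bound 1, supplied by the
    indicator \<open>?hi\<close>, suffices. Including 1 \<le> z makes \<open>s\<close> and
    \<open>c\<close> nonnegative everywhere, not just almost everywhere.\<close>
  define low where "low z \<longleftrightarrow> 1 \<le> z \<and> z - 1 \<le> a" for z :: real
  have [measurable]: "Measurable.pred borel low" unfolding low_def by measurable
  define s where "s z = (if low z then chord_slope b z else 0)" for z
  define c where "c z = (if low z then chord_offset b z else 0)" for z
  have [measurable]: "s \<in> borel_measurable borel" "c \<in> borel_measurable borel"
    unfolding s_def c_def chord_slope_def chord_offset_def by measurable
  have s0: "0 \<le> s z" and c0: "0 \<le> c z" for z
    using b by (auto simp: s_def c_def low_def chord_slope_def chord_offset_def)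
  \<comment> \<open>A uniform bound makes the integral \<open>?C\<close> of the offset finite, so
    that it can be cancelled at the end.\<close>
  have c_le: "c z \<le> (b + 2 * a + 2 * a * b) / b\<^sup>2" for z
    using a b by (auto simp: c_def low_def chord_offset_def intro!: divide_right_mono add_mono mult_right_mono)
  let ?hi = "\<lambda>\<omega>. indicator {z. \<not> low z} (x \<omega>) :: ennreal"
  have upper: "AE \<omega> in M. ennreal (potential b (y \<omega>)) + ennreal (c (x \<omega>))
      \<le> ennreal (s (x \<omega>)) * ennreal (y \<omega>) + ?hi \<omega>"
    using x1 gap
  proof eventually_elim
    case (elim \<omega>)
    show ?case
    proof (cases "low (x \<omega>)")
      case True
      then have "potential b (y \<omega>) + c (x \<omega>) \<le> s (x \<omega>) * y \<omega>"
        using elim ab b potential_le_chord[of b "x \<omega>" "y \<omega>"]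
        by (auto simp: low_def s_def c_def)
      then have "ennreal (potential b (y \<omega>) + c (x \<omega>)) \<le> ennreal (s (x \<omega>) * y \<omega>)"
        by (rule ennreal_leI)
      then show ?thesis
        using True elim by (simp add: ennreal_plus ennreal_mult s0 c0 potential_nonneg)
    next
      case False
      then show ?thesis by (simp add: s_def c_def potential_le_1)
    qed
  qed
  have lower: "AE \<omega> in M. ennreal (s (x \<omega>)) * nn_cond_exp M F (\<lambda>\<omega>. ennreal (y \<omega>)) \<omega> + ?hi \<omega>
      \<le> ennreal (potential a (x \<omega>)) + ennreal (c (x \<omega>))"
    using x1 cond
  proof eventually_elim
    case (elim \<omega>)
    show ?case
    proof (cases "low (x \<omega>)")
      case True
      have "ennreal (s (x \<omega>)) * nn_cond_exp M F (\<lambda>\<omega>. ennreal (y \<omega>)) \<omega>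
          \<le> ennreal (s (x \<omega>)) * ennreal ((x \<omega>)\<^sup>2)"
        using elim by (intro mult_left_mono) auto
      also have "\<dots> = ennreal (s (x \<omega>) * (x \<omega>)\<^sup>2)"
        by (simp add: ennreal_mult s0)
      also have "\<dots> \<le> ennreal (potential a (x \<omega>) + c (x \<omega>))"
        using True chord_at_square_le_potential[OF a, of "x \<omega>"]
        by (intro ennreal_leI) (auto simp: low_def s_def c_def b_def)
      finally show ?thesis
        using True by (simp add: ennreal_plus c0 potential_nonneg)
    next
      case False
      then have "1 + a \<le> x \<omega>" using elim by (auto simp: low_def)
      then show ?thesis using False a by (simp add: s_def c_def potential_eq_1)
    qed
  qed
  let ?C = "\<integral>\<^sup>+ \<omega>. ennreal (c (x \<omega>)) \<partial>M"
  have "?C \<le> (\<integral>\<^sup>+ \<omega>. ennreal ((b + 2 * a + 2 * a * b) / b\<^sup>2) \<partial>M)"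
    by (intro nn_integral_mono ennreal_leI c_le)
  also have "\<dots> < \<infinity>"
    by (simp add: ennreal_mult_less_top emeasure_eq_measure)
  finally have C: "?C < \<infinity>" .
  have "(\<integral>\<^sup>+ \<omega>. ennreal (potential b (y \<omega>)) \<partial>M) + ?C
      = (\<integral>\<^sup>+ \<omega>. ennreal (potential b (y \<omega>)) + ennreal (c (x \<omega>)) \<partial>M)"
    by (simp add: nn_integral_add)
  also have "\<dots> \<le> (\<integral>\<^sup>+ \<omega>. ennreal (s (x \<omega>)) * ennreal (y \<omega>) + ?hi \<omega> \<partial>M)"
    using upper by (rule nn_integral_mono_AE)
  also have "\<dots> = (\<integral>\<^sup>+ \<omega>. ennreal (s (x \<omega>)) * ennreal (y \<omega>) \<partial>M) + (\<integral>\<^sup>+ \<omega>. ?hi \<omega> \<partial>M)"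
    by (intro nn_integral_add) measurable
  \<comment> \<open>The defining property of conditional expectation, tested against the
    \<open>F\<close>-measurable weight \<open>s (x \<omega>)\<close>.\<close>
  also have "(\<integral>\<^sup>+ \<omega>. ennreal (s (x \<omega>)) * ennreal (y \<omega>) \<partial>M)
      = (\<integral>\<^sup>+ \<omega>. ennreal (s (x \<omega>)) * nn_cond_exp M F (\<lambda>\<omega>. ennreal (y \<omega>)) \<omega> \<partial>M)"
    by (intro nn_cond_exp_intg[symmetric]) measurable
  also have "\<dots> + (\<integral>\<^sup>+ \<omega>. ?hi \<omega> \<partial>M)
      = (\<integral>\<^sup>+ \<omega>. ennreal (s (x \<omega>)) * nn_cond_exp M F (\<lambda>\<omega>. ennreal (y \<omega>)) \<omega> + ?hi \<omega> \<partial>M)"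
    by (intro nn_integral_add[symmetric]) measurable
  also have "\<dots> \<le> (\<integral>\<^sup>+ \<omega>. ennreal (potential a (x \<omega>)) + ennreal (c (x \<omega>)) \<partial>M)"
    using lower by (rule nn_integral_mono_AE)
  also have "\<dots> = (\<integral>\<^sup>+ \<omega>. ennreal (potential a (x \<omega>)) \<partial>M) + ?C"
    by (simp add: nn_integral_add)
  finally show ?thesis
    using C by (auto simp: b_def ennreal_add_left_cancel_le add.commute[of _ ?C])
qed

section \<open>The sigma-algebra generated by the history\<close>

lemma space_history_algebra: "space (history_algebra M X i) = space M"
  unfolding history_algebra_def by (rule space_measure_of) auto

lemma sets_history_algebra:
  "sets (history_algebra M X i) =
     sigma_sets (space M) (\<Union>j\<in>{..i}. {X j -` A \<inter> space M | A. A \<in> sets borel})"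
  unfolding history_algebra_def by (rule sets_measure_of) auto

lemma measurable_history_algebra:
  assumes "j \<le> i"
  shows "X j \<in> borel_measurable (history_algebra M X i)"
  using assms
  by (intro measurableI) (auto simp: space_history_algebra sets_history_algebra)

lemma subalgebra_history_algebra:
  assumes "\<And>j. j \<le> i \<Longrightarrow> X j \<in> borel_measurable M"
  shows "subalgebra M (history_algebra M X i)"
  unfolding subalgebra_def space_history_algebra sets_history_algebra
  using assms by (auto intro!: sets.sigma_sets_subset)

lemma sigma_finite_subalgebra_history_algebra:
  assumes "finite_measure M" "\<And>j. j \<le> i \<Longrightarrow> X j \<in> borel_measurable M"
  shows "sigma_finite_subalgebra M (history_algebra M X i)"
proof -
  interpret finite_measure M by fact
  interpret finite_measure_subalgebra M "history_algebra M X i"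
    by unfold_locales (rule subalgebra_history_algebra[OF assms(2)])
  show ?thesis ..
qed

section \<open>Iteration of the step and the tail bound\<close>

theorem theorem5p1:
  fixes M :: "'a measure" and X :: "nat \<Rightarrow> 'a \<Rightarrow> real" and x0 t :: real and k :: nat
  assumes "prob_space M"
    and "x0 > 1"
    and "\<And>\<omega>. \<omega> \<in> space M \<Longrightarrow> X 0 \<omega> = x0"
    and "\<And>i. 1 \<le> i \<Longrightarrow> i \<le> k \<Longrightarrow> X i \<in> borel_measurable M"
    and "\<And>i. i < k \<Longrightarrow> AE \<omega> in M. X (Suc i) \<omega> - 1 \<ge> 2 * (X i \<omega> - 1)"
    and "\<And>i. i < k \<Longrightarrow>
           AE \<omega> in M. cond_exp_history M X i (X (Suc i)) \<omega> \<le> ennreal ((X i \<omega>)\<^sup>2)"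
    and "1 + 4 * (x0 - 1) \<le> t"
    and "t \<le> 2"
  shows "\<P>(\<omega> in M. X k \<omega> \<ge> t powr (2 powr (real k - 1))) \<le> 48 * ((x0 - 1) / (t - 1))\<^sup>2"
proof -
  interpret prob_space M by fact
  have t: "1 < t" using assms(2,7) by simp
  have meas: "X i \<in> borel_measurable M" if "i \<le> k" for i
  proof (cases "i = 0")
    case True
    have "X 0 \<in> borel_measurable M \<longleftrightarrow> (\<lambda>_. x0) \<in> borel_measurable M"
      by (rule measurable_cong) (rule assms(3))
    then show ?thesis using True by simp
  qed (use that assms(4) in auto)
  have ge1: "AE \<omega> in M. 1 \<le> X i \<omega>" if "i \<le> k" for i
    using that
  proof (induction i)
    case 0
    show ?case using assms(2,3) by (intro AE_I2) simp
  next
    case (Suc i)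
    then have "AE \<omega> in M. 1 \<le> X i \<omega>" and "AE \<omega> in M. X (Suc i) \<omega> - 1 \<ge> 2 * (X i \<omega> - 1)"
      using assms(5) by auto
    then show ?case by eventually_elim simp
  qed
  \<comment> \<open>The exponent uses real subtraction, so at i = 0 it is 1/2 and \<open>a 0\<close>
    is sqrt t - 1.\<close>
  define a where "a i = t powr (2 powr (real i - 1)) - 1" for i :: nat
  have a_pos: "0 < a i" for i
    using t by (simp add: a_def)
  have a_Suc: "a (Suc i) = a i * (a i + 2)" for i
  proof -
    have "2 powr (real (Suc i) - 1) = 2 * 2 powr (real i - 1)"
      by (simp add: powr_diff)
    then have "t powr (2 powr (real (Suc i) - 1)) = (t powr (2 powr (real i - 1)))\<^sup>2"
      using t by (simp add: powr_power mult.commute)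
    then show ?thesis by (simp add: a_def power2_eq_square algebra_simps)
  qed
  have pot: "(\<integral>\<^sup>+ \<omega>. ennreal (potential (a i) (X i \<omega>)) \<partial>M) \<le> ennreal (potential (a 0) x0)"
    if "i \<le> k" for i
    using that
  proof (induction i)
    case 0
    have "(\<integral>\<^sup>+ \<omega>. ennreal (potential (a 0) (X 0 \<omega>)) \<partial>M) = (\<integral>\<^sup>+ \<omega>. ennreal (potential (a 0) x0) \<partial>M)"
      by (intro nn_integral_cong) (simp add: assms(3))
    then show ?case by (simp add: emeasure_space_1)
  next
    case (Suc i)
    interpret H: sigma_finite_subalgebra M "history_algebra M X i"
      using Suc.prems by (intro sigma_finite_subalgebra_history_algebra meas finite_measure_axioms) auto
    have "(\<integral>\<^sup>+ \<omega>. ennreal (potential (a (Suc i)) (X (Suc i) \<omega>)) \<partial>M)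
        \<le> (\<integral>\<^sup>+ \<omega>. ennreal (potential (a i) (X i \<omega>)) \<partial>M)"
      unfolding a_Suc
      using Suc.prems assms(5,6)[of i]
      by (intro H.nn_integral_potential_step finite_measure_axioms measurable_history_algebra meas ge1 a_pos)
         (auto simp: cond_exp_history_def)
    also have "\<dots> \<le> ennreal (potential (a 0) x0)"
      using Suc by simp
    finally show ?case .
  qed
  let ?E = "{\<omega> \<in> space M. X k \<omega> \<ge> t powr (2 powr (real k - 1))}"
  have [measurable]: "X k \<in> borel_measurable M" by (simp add: meas)
  have "emeasure M ?E = (\<integral>\<^sup>+ \<omega>. indicator ?E \<omega> \<partial>M)"
    by (rule nn_integral_indicator[symmetric]) measurable
  \<comment> \<open>On the event, \<open>X k\<close> is at least \<open>1 + a k\<close>, so the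
    potential equals 1 there.\<close>
  also have "\<dots> \<le> (\<integral>\<^sup>+ \<omega>. ennreal (potential (a k) (X k \<omega>)) \<partial>M)"
    using a_pos[of k]
    by (intro nn_integral_mono) (auto simp: indicator_def potential_eq_1 a_def)
  also have "\<dots> \<le> ennreal (potential (a 0) x0)"
    by (simp add: pot)
  finally have "prob ?E \<le> potential (a 0) x0"
    by (simp add: emeasure_eq_measure potential_nonneg)
  also have "\<dots> \<le> ((x0 - 1) / (sqrt t - 1))\<^sup>2"
    using t by (simp add: potential_def a_def powr_minus powr_half_sqrt[symmetric])
  also have "(x0 - 1) / (sqrt t - 1) = (sqrt t + 1) * ((x0 - 1) / (t - 1))"
  proof -
    have t_eq: "t - 1 = (sqrt t + 1) * (sqrt t - 1)"
      using t by (simp add: algebra_simps)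
    have "0 < sqrt t" using t by simp
    then have "sqrt t + 1 \<noteq> 0" by linarith
    then show ?thesis unfolding t_eq by simp
  qed
  also have "(\<dots>)\<^sup>2 = (sqrt t + 1)\<^sup>2 * ((x0 - 1) / (t - 1))\<^sup>2"
    by (rule power_mult_distrib)
  also have "\<dots> \<le> 48 * ((x0 - 1) / (t - 1))\<^sup>2"
  proof (rule mult_right_mono)
    \<comment> \<open>The crude bound sqrt t \<le> 2 already gives the factor 9, well below
      48.\<close>
    have "sqrt t \<le> 2" using assms(8) by (intro real_le_lsqrt) auto
    then have "(sqrt t + 1)\<^sup>2 \<le> 3\<^sup>2" using t by (intro power_mono) auto
    then show "(sqrt t + 1)\<^sup>2 \<le> 48" by simp
  qed simp
  finally show ?thesis .
qed

end
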